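(* In the contextual modal calculus $\lambda^{[-]}$, for every level $l$, all lists $\Gamma,\Gamma'$ of level-$l$ types and all level-$l$ types $A,B,B'$, the following types of level $l+1$ are inhabited by closed terms (with empty context stack): $[\Gamma]A\to[\Gamma,B]A$; $[\Gamma,B,B]A\to[\Gamma,B]A$; $[\Gamma,B,B',\Gamma']A\to[\Gamma,B',B,\Gamma']A$; and $[\Gamma]B\to[\Gamma,B]A\to[\Gamma]A$.
   Context: $\lambda^{[-]}$: levels are natural numbers; types of level $l$ are base types $\iota^l$, $A^l\to B^l$, and (for $l\ge1$) contextual modal types $[A_1,\dots,A_n]B$ with $A_i,B$ of level $l-1$. A context of level $l$ is a list of variable declarations of level-$l$ types; $\mathrm{rg}(\Gamma)$ is the list of its types and $\mathrm{dom}(\Gamma)$ its variables; a context stack of level $l$ is a sequence $\Gamma^{l+n-1};\dots;\Gamma^l$ ($n\ge0$) with levels decreasing by one from left to right. Rules: (Var) if $x:A\in\Gamma^l$ then $\Delta^{l+1};\Gamma^l\vdash^l x:A$; (Abs) from $\Delta^{l+1};\Gamma^l,x:A\vdash^l M:B$ infer $\Delta^{l+1};\Gamma^l\vdash^l\lambda x.M:A\to B$; (App) from $\Delta^l\vdash^l M:A\to B$ and $\Delta^l\vdash^l N:A$ infer $\Delta^l\vdash^l MN:B$; (Quo) from $\Delta;\Gamma\vdash^l M:B$ infer $\Delta\vdash^{l+1}\grave{}^{\langle\mathrm{dom}(\Gamma)\rangle}M:[\mathrm{rg}(\Gamma)]B$; (Unq) from $\Delta\vdash^{l+1}M:[A_1,\dots,A_n]B$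 and $\Delta;\Gamma\vdash^l N_i:A_i$ for $i=1,\dots,n$ infer $\Delta;\Gamma\vdash^l{,}_{\langle N_1,\dots,N_n\rangle}M:B$.
   Formalization: "Empty context stack" is taken as the stack consisting of one empty context of level l+1 (no variables declared); in the stack of length 0 no function type is inhabited, since Abs needs a context, so the literal claim would fail. *)

theory Defs
  imports Main
begin

text \<open>
  The contextual modal calculus \<open>\<lambda>\<^bsup>[-]\<^esup>\<close>.  Base types are tagged with their level and a name;
  the type \<open>'b\<close> of names is arbitrary (\<open>unit\<close> gives exactly one base type per level).
\<close>

datatype 'b ty =
    Base nat 'b
  | Arr "'b ty" "'b ty"        (infixr "\<rightarrow>" 60)
  | Box "'b ty list" "'b ty"   ("[_]\<rhd> _" [0, 61] 61)

inductive has_level :: "nat \<Rightarrow> 'b ty \<Rightarrow> bool" where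
  "has_level l (Base l b)"
| "has_level l A \<Longrightarrow> has_level l B \<Longrightarrow> has_level l (A \<rightarrow> B)"
| "(\<forall>A \<in> set As. has_level l A) \<Longrightarrow> has_level l B \<Longrightarrow> has_level (Suc l) ([As]\<rhd> B)"

type_synonym var = nat

datatype tm =
    Var var
  | Lam var tm
  | App tm tm
  | Quo "var list" tm
  | Unq "tm list" tm

type_synonym 'b ctx = "(var \<times> 'b ty) list"

abbreviation dom_ctx :: "'b ctx \<Rightarrow> var list" where
  "dom_ctx \<Gamma> \<equiv> map fst \<Gamma>"

abbreviation rg :: "'b ctx \<Rightarrow> 'b ty list" where
  "rg \<Gamma> \<equiv> map snd \<Gamma>"

text \<open>
  A context declares each variable at most once.  Declarations are listed from left to right,
  so \<open>\<Gamma>, x:A\<close> is \<open>\<Gamma> @ [(x, A)]\<close>.  A stack is listed from right to left: \<open>\<Delta>; \<Gamma>\<close> is \<open>\<Gamma> # \<Delta>\<close>,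
  the head being the context of the lowest level.
\<close>

definition wf_ctx :: "nat \<Rightarrow> 'b ctx \<Rightarrow> bool" where
  "wf_ctx l \<Gamma> \<longleftrightarrow> distinct (dom_ctx \<Gamma>) \<and> (\<forall>A \<in> set (rg \<Gamma>). has_level l A)"

type_synonym 'b stack = "'b ctx list"

fun wf_stack :: "nat \<Rightarrow> 'b stack \<Rightarrow> bool" where
  "wf_stack l [] \<longleftrightarrow> True"
| "wf_stack l (\<Gamma> # \<Delta>) \<longleftrightarrow> wf_ctx l \<Gamma> \<and> wf_stack (Suc l) \<Delta>"

text \<open>
  The well-formedness premises of the rules for variables and unquotation ensure that only stacks
  of the right level occur (lemma \<open>typing_wf\<close>).  For unquotation the premise matters only for
  an empty argument list, where no other premise mentions \<open>\<Gamma>\<close>.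
\<close>

inductive typing :: "'b stack \<Rightarrow> nat \<Rightarrow> tm \<Rightarrow> 'b ty \<Rightarrow> bool"
  ("_ \<turnstile>\<^bsub>_\<^esub> _ : _" [50, 0, 50, 50] 50)
where
  T_Var: "\<lbrakk>wf_stack l (\<Gamma> # \<Delta>); (x, A) \<in> set \<Gamma>\<rbrakk> \<Longrightarrow> \<Gamma> # \<Delta> \<turnstile>\<^bsub>l\<^esub> Var x : A"
| T_Abs: "(\<Gamma> @ [(x, A)]) # \<Delta> \<turnstile>\<^bsub>l\<^esub> M : B \<Longrightarrow> \<Gamma> # \<Delta> \<turnstile>\<^bsub>l\<^esub> Lam x M : A \<rightarrow> B"
| T_App: "\<lbrakk>\<Delta> \<turnstile>\<^bsub>l\<^esub> M : A \<rightarrow> B; \<Delta> \<turnstile>\<^bsub>l\<^esub> N : A\<rbrakk> \<Longrightarrow> \<Delta> \<turnstile>\<^bsub>l\<^esub> App M N : B"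
| T_Quo: "\<Gamma> # \<Delta> \<turnstile>\<^bsub>l\<^esub> M : B \<Longrightarrow> \<Delta> \<turnstile>\<^bsub>Suc l\<^esub> Quo (dom_ctx \<Gamma>) M : [rg \<Gamma>]\<rhd> B"
| T_Unq: "\<lbrakk>\<Delta> \<turnstile>\<^bsub>Suc l\<^esub> M : [As]\<rhd> B; wf_ctx l \<Gamma>;
           list_all2 (\<lambda>N A. \<Gamma> # \<Delta> \<turnstile>\<^bsub>l\<^esub> N : A) Ns As\<rbrakk> \<Longrightarrow> \<Gamma> # \<Delta> \<turnstile>\<^bsub>l\<^esub> Unq Ns M : B"

lemma typing_wf:
  "\<Delta> \<turnstile>\<^bsub>l\<^esub> M : A \<Longrightarrow> wf_stack l \<Delta> \<and> has_level l A"
proof (induction rule: typing.induct)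
  case (T_Var l \<Gamma> \<Delta> x A)
  then show ?case by (force simp: wf_ctx_def)
next
  case (T_Abs \<Gamma> x A \<Delta> l M B)
  then show ?case by (auto simp: wf_ctx_def intro: has_level.intros)
next
  case (T_Quo \<Gamma> \<Delta> l M B)
  then show ?case by (auto simp: wf_ctx_def intro!: has_level.intros)
qed (auto elim: has_level.cases)

text \<open>
  The judgment without any variable declarations.  ``Empty context stack'' cannot be read as the
  stack of length 0: abstraction and variables require at least one context, so no
  function type is inhabited there (lemma \<open>no_Arr_in_empty_stack\<close>).  An inhabitant without
  declarations is a term typed in the empty context of its own level, the stack \<open>[[]]\<close> written as
  nothing in \<open>\<turnstile>\<^bsup>l\<^esup> M : A\<close>.  This includes all terms typed in the stack of length 0
  (lemma \<open>typing_add_empty_ctx\<close> with \<open>\<Delta> = []\<close>).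
\<close>

definition closed_inhabited :: "nat \<Rightarrow> 'b ty \<Rightarrow> bool" where
  "closed_inhabited l A \<longleftrightarrow> (\<exists>M. [[]] \<turnstile>\<^bsub>l\<^esub> M : A)"

lemma no_Arr_in_empty_stack: "\<not> [] \<turnstile>\<^bsub>l\<^esub> M : A \<rightarrow> B"
proof
  assume "[] \<turnstile>\<^bsub>l\<^esub> M : A \<rightarrow> B"
  then show False
    by (induction "[] :: 'a stack" l M "A \<rightarrow> B" arbitrary: A B rule: typing.induct)
qed

lemma typing_add_empty_ctx:
  "\<Delta> \<turnstile>\<^bsub>l\<^esub> M : A \<Longrightarrow> \<Delta> @ [[]] \<turnstile>\<^bsub>l\<^esub> M : A"
proof (induction rule: typing.induct)
  case (T_Var l \<Gamma> \<Delta> x A)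
  have "wf_stack k \<Delta> \<Longrightarrow> wf_stack k (\<Delta> @ [[]])" for k
    by (induction k \<Delta> rule: wf_stack.induct) (auto simp: wf_ctx_def)
  with T_Var show ?case by (auto intro: typing.T_Var)
next
  case (T_Unq \<Delta> l M As B \<Gamma> Ns)
  then show ?case by (auto intro!: typing.T_Unq elim: list_all2_mono)
qed (auto intro: typing.intros)

end

theory Submission
  imports Defs
begin

text \<open>
  Splicing a quoted term into a quotation over another context needs, for each declared type, an
  argument in the new context.  Each structural rule only needs variables for arguments; for cut,
  the last argument is itself a splice.
\<close>

text \<open>Positions serve as variable names, so distinctness of the declarations is automatic even
  when \<open>Ds\<close> repeats a type.\<close>

definition fresh_ctx :: "'b ty list \<Rightarrow> 'b ctx" where
  "fresh_ctx Ds = zip [0..<length Ds] Ds"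

lemma rg_fresh_ctx [simp]: "rg (fresh_ctx Ds) = Ds"
  by (simp add: fresh_ctx_def)

lemma wf_fresh_ctx: "\<forall>D \<in> set Ds. has_level l D \<Longrightarrow> wf_ctx l (fresh_ctx Ds)"
  by (simp add: wf_ctx_def fresh_ctx_def)

lemma fresh_ctx_inhabits:
  assumes "\<forall>D \<in> set Ds. has_level l D" "wf_stack (Suc l) \<Delta>" "D \<in> set Ds"
  shows "\<exists>N. fresh_ctx Ds # \<Delta> \<turnstile>\<^bsub>l\<^esub> N : D"
proof -
  have "D \<in> snd ` set (fresh_ctx Ds)"
    using \<open>D \<in> set Ds\<close> rg_fresh_ctx[of Ds] by (metis set_map)
  then obtain x where "(x, D) \<in> set (fresh_ctx Ds)"
    by auto
  then show ?thesis
    using assms wf_fresh_ctx[of Ds l] typing.T_Var[of l "fresh_ctx Ds" \<Delta>] by auto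
qed

text \<open>One term is chosen per type rather than per position, so equal entries of
  \<open>Cs\<close> receive the same argument. Hence only \<open>set Cs\<close> matters, not order
  or multiplicity.\<close>

lemma splice_inhabits:
  assumes "\<Delta> \<turnstile>\<^bsub>Suc l\<^esub> M : [Cs]\<rhd> A" "wf_ctx l \<Gamma>"
    and "\<forall>C \<in> set Cs. \<exists>N. \<Gamma> # \<Delta> \<turnstile>\<^bsub>l\<^esub> N : C"
  shows "\<exists>N. \<Gamma> # \<Delta> \<turnstile>\<^bsub>l\<^esub> N : A"
proof -
  obtain f where "\<forall>C \<in> set Cs. \<Gamma> # \<Delta> \<turnstile>\<^bsub>l\<^esub> f C : C"
    using bchoice[OF assms(3)] by blast
  then have "list_all2 (\<lambda>N C. \<Gamma> # \<Delta> \<turnstile>\<^bsub>l\<^esub> N : C) (map f Cs) Cs"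
    by (simp add: list_all2_map1 list_all2_same)
  with assms(1,2) show ?thesis
    by (blast intro: typing.T_Unq)
qed

lemma Quo_fresh_ctx:
  "fresh_ctx Ds # \<Delta> \<turnstile>\<^bsub>l\<^esub> M : A \<Longrightarrow> \<exists>N. \<Delta> \<turnstile>\<^bsub>Suc l\<^esub> N : [Ds]\<rhd> A"
  by (metis rg_fresh_ctx typing.T_Quo)

text \<open>Weakening, contraction and exchange differ only in how \<open>Cs\<close> and
  \<open>Ds\<close> are arranged. Since arguments are selected by type, inclusion of the underlying
  sets covers all three. The inhabitant abstracts over a quotation whose body splices the bound
  variable at variables of \<open>fresh_ctx Ds\<close>.\<close>

lemma box_structural:
  assumes "\<forall>D \<in> set Ds. has_level l D" "has_level l A" "set Cs \<subseteq> set Ds"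
  shows "closed_inhabited (Suc l) ([Cs]\<rhd> A \<rightarrow> [Ds]\<rhd> A)"
proof -
  \<comment> \<open>The name 0 may also be declared in \<open>fresh_ctx Ds\<close>, one level below.
    There is no capture: a variable is looked up only in the head context, and \<open>Unq\<close>
    removes that context before its body is typed.\<close>
  let ?\<Delta> = "[[(0, [Cs]\<rhd> A)]]"
  have "has_level (Suc l) ([Cs]\<rhd> A)"
    using assms by (auto intro!: has_level.intros)
  then have wf: "wf_stack (Suc l) ?\<Delta>"
    by (simp add: wf_ctx_def)
  then have "?\<Delta> \<turnstile>\<^bsub>Suc l\<^esub> Var 0 : [Cs]\<rhd> A"
    by (simp add: typing.T_Var)
  moreover have "\<forall>C \<in> set Cs. \<exists>N. fresh_ctx Ds # ?\<Delta> \<turnstile>\<^bsub>l\<^esub> N : C"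
    using fresh_ctx_inhabits[OF assms(1) wf] assms(3) by blast
  ultimately obtain N where "?\<Delta> \<turnstile>\<^bsub>Suc l\<^esub> N : [Ds]\<rhd> A"
    using splice_inhabits wf_fresh_ctx[OF assms(1)] Quo_fresh_ctx by metis
  then have "[[]] \<turnstile>\<^bsub>Suc l\<^esub> Lam 0 N : [Cs]\<rhd> A \<rightarrow> [Ds]\<rhd> A"
    by (simp add: typing.T_Abs)
  then show ?thesis
    unfolding closed_inhabited_def by blast
qed

lemma box_cut:
  assumes "\<forall>D \<in> set Ds. has_level l D" "has_level l A" "has_level l B"
  shows "closed_inhabited (Suc l) ([Ds]\<rhd> B \<rightarrow> [Ds @ [B]]\<rhd> A \<rightarrow> [Ds]\<rhd> A)"
proof -
  let ?\<Delta> = "[[(0, [Ds]\<rhd> B), (1, [Ds @ [B]]\<rhd> A)]]"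
  have "has_level (Suc l) ([Ds]\<rhd> B)" "has_level (Suc l) ([Ds @ [B]]\<rhd> A)"
    using assms by (auto intro!: has_level.intros)
  then have wf: "wf_stack (Suc l) ?\<Delta>"
    by (simp add: wf_ctx_def)
  then have f: "?\<Delta> \<turnstile>\<^bsub>Suc l\<^esub> Var 0 : [Ds]\<rhd> B" and g: "?\<Delta> \<turnstile>\<^bsub>Suc l\<^esub> Var 1 : [Ds @ [B]]\<rhd> A"
    by (simp_all add: typing.T_Var)
  note vars = fresh_ctx_inhabits[OF assms(1) wf]
  \<comment> \<open>Inner splice: \<open>Var 0\<close> applied to the variables of the quoted
    context yields the argument for the extra type \<open>B\<close>.\<close>
  have "\<exists>N. fresh_ctx Ds # ?\<Delta> \<turnstile>\<^bsub>l\<^esub> N : B"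
    using splice_inhabits[OF f wf_fresh_ctx[OF assms(1)]] vars by blast
  then have "\<forall>C \<in> set (Ds @ [B]). \<exists>N. fresh_ctx Ds # ?\<Delta> \<turnstile>\<^bsub>l\<^esub> N : C"
    using vars by auto
  \<comment> \<open>Outer splice: \<open>Var 1\<close> takes these arguments, and quoting the result
    discharges the fresh context.\<close>
  from splice_inhabits[OF g wf_fresh_ctx[OF assms(1)] this]
  obtain N where "?\<Delta> \<turnstile>\<^bsub>Suc l\<^esub> N : [Ds]\<rhd> A"
    using Quo_fresh_ctx by metis
  then have "[[]] \<turnstile>\<^bsub>Suc l\<^esub> Lam 0 (Lam 1 N) : [Ds]\<rhd> B \<rightarrow> [Ds @ [B]]\<rhd> A \<rightarrow> [Ds]\<rhd> A"
    by (simp add: typing.T_Abs)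
  then show ?thesis
    unfolding closed_inhabited_def by blast
qed

theorem theorem6p1:
  fixes l :: nat and \<Gamma> \<Gamma>' :: "'b ty list" and A B B' :: "'b ty"
  assumes "\<forall>C \<in> set \<Gamma>. has_level l C"
    and "\<forall>C \<in> set \<Gamma>'. has_level l C"
    and "has_level l A" and "has_level l B" and "has_level l B'"
  shows "closed_inhabited (Suc l) ([\<Gamma>]\<rhd> A \<rightarrow> [\<Gamma> @ [B]]\<rhd> A)
    \<and> closed_inhabited (Suc l) ([\<Gamma> @ [B, B]]\<rhd> A \<rightarrow> [\<Gamma> @ [B]]\<rhd> A)
    \<and> closed_inhabited (Suc l) ([\<Gamma> @ [B, B'] @ \<Gamma>']\<rhd> A \<rightarrow> [\<Gamma> @ [B', B] @ \<Gamma>']\<rhd> A)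
    \<and> closed_inhabited (Suc l) ([\<Gamma>]\<rhd> B \<rightarrow> [\<Gamma> @ [B]]\<rhd> A \<rightarrow> [\<Gamma>]\<rhd> A)"
  \<comment> \<open>Only the last type has an arrow as codomain, so it alone matches
    \<open>box_cut\<close>. In the other three, what remains is membership and inclusion of sets of
    types.\<close>
  using assms by (intro conjI box_structural box_cut) auto

end
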